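(* Let $p\equiv 1\pmod 8$ be prime and write $p=s^2+t^2$ with integers $s\equiv 1\pmod 4$ and $t>0$. Let $g$ be a generator of $\mathbb{Z}_p^\ast$, put $G_j=\{g^{4k+j}:k\in\mathbb{Z}\}$ for $j=0,1,2,3$, and assume $g$ is chosen so that $\#\{b\in G_0: b+1\in G_1\}>\#\{b\in G_0: b+1\in G_3\}$. Fix a sign $\pm$ and put \[\zeta=\frac{2(-1\pm\sqrt p)}{p-1},\quad A=\frac{2p(p-2s+1)}{t^2(p-1)^2},\quad B=\pm\frac{2(p(s-2)+s)}{t^2(p-1)^2},\] \[C=\frac{p\left(p(t^2+2)-4s-3t^2+2\right)}{t^2(p-1)^2},\quad D=\pm\frac{2\left(p(s-2)+s+t^2\right)}{t^2(p-1)^2}\] (all signs equal to the chosen one); then $A+B\sqrt p>0$ and $C+D\sqrt p>0$. Let \[\alpha=\frac{\zeta}{2}+\sqrt{A+B\sqrt p}-\sqrt{C+D\sqrt p},\qquad \beta=\frac{\zeta}{2}-\sqrt{A+B\sqrt p}+\sqrt{C+D\sqrt p},\] which satisfy $|\alpha|,|\beta|\le 1$, and set $a=\alpha+i\sqrt{1-\alpha^2}$, $b=\beta+i\sqrt{1-\beta^2}$, $(c_0,c_1,c_2,c_3)=(a,b,\overline a,\overline b)$. Define $x=(x_k)_{k\in\mathbb{Z}_p}$ by $x_0=1$ and $x_k=c_j$ for $k\in G_j$. Then the circulant matrix $\mathrm{Circ}(x)$ is a symmetric complex Hadamard matrix of order $p$. (The same holds with $(c_0,c_1,c_2,c_3)$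 replaced by any cyclic permutation of $(a,b,\overline a,\overline b)$.)
   Context: For $x=(x_0,\dots,x_{p-1})$, $\mathrm{Circ}(x)$ is the $p\times p$ matrix with $(i,j)$ entry $x_{j-i}$, indices modulo $p$. A complex Hadamard matrix of order $n$ is an $n\times n$ complex matrix with all entries of modulus $1$ satisfying $HH^\ast=nI_n$. Square roots of positive reals denote the positive root. *)

theory Defs
  imports Complex_Main "HOL-Number_Theory.Number_Theory" "Jordan_Normal_Form.Matrix"
begin

definition Circ :: "nat \<Rightarrow> (nat \<Rightarrow> complex) \<Rightarrow> complex mat" where
  "Circ p x = mat p p (\<lambda>(i, j). x ((j + p - i) mod p))"

definition conj_transpose :: "complex mat \<Rightarrow> complex mat" where
  "conj_transpose H = mat (dim_col H) (dim_row H) (\<lambda>(i, j). cnj (H $$ (j, i)))"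

definition complex_hadamard :: "nat \<Rightarrow> complex mat \<Rightarrow> bool" where
  "complex_hadamard n H \<longleftrightarrow> H \<in> carrier_mat n n \<and>
     (\<forall>i<n. \<forall>j<n. cmod (H $$ (i, j)) = 1) \<and>
     H * conj_transpose H = of_nat n \<cdot>\<^sub>m 1\<^sub>m n"

definition cyc_class :: "nat \<Rightarrow> nat \<Rightarrow> nat \<Rightarrow> nat set" where
  "cyc_class p g j = {y. y < p \<and> (\<exists>k::nat. [g ^ (4 * k + j) = y] (mod p))}"

end

theory Submission
  imports Defs
begin

text \<open>
  Put \<open>q = \<sigma> * sqrt p\<close>, \<open>z = 1 / (q + 1)\<close> and \<open>K = (q + s) / (t * (q + 1))\<close>. Then \<open>\<zeta> = 2 * z\<close>,
  \<open>A + B * sqrt p = z\<^sup>2 + K\<^sup>2\<close> and \<open>C + D * sqrt p = 1 + K\<^sup>2\<close>, which makes the bounds on \<open>\<alpha>\<close>, \<open>\<beta>\<close>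
  elementary and gives \<open>sqrt (1 - \<alpha>\<^sup>2) * sqrt (1 - \<beta>\<^sup>2) = (\<beta> - \<alpha>) * K\<close>.

  The autocorrelation of \<open>x\<close> at a nonzero shift is a quadratic form in the values on the quartic
  classes whose coefficients are the cyclotomic numbers of order four. As \<open>-1\<close> is a fourth power, their
  symmetries leave five unknowns, and three linear relations come from counting rows. The last
  relation is \<open>\<bar>J\<bar>\<^sup>2 = p\<close> for the Jacobi sum of a quartic character, obtained by counting the
  additive energy of the character through its self-convolution and through its autocorrelation.
  Unique representability of \<open>p\<close> as a sum of two squares then expresses all cyclotomic numbers by \<open>s\<close>
  and \<open>t\<close>, the sign of \<open>t\<close> being fixed by the assumption on \<open>g\<close>. What remains are two real
  equations in \<open>\<alpha>\<close> and \<open>\<beta>\<close>, one for each parity of the class of the shift.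
\<close>

subsection \<open>The radicals\<close>

text \<open>Both numbers are z shifted by the gap between two hypotenuses with common leg K and
  other legs |z| and 1. The gap is nonnegative and, by the triangle inequality, at most 1 -
  |z|.\<close>

lemma half_gap_bounds:
  fixes z K :: real
  assumes "\<bar>z\<bar> < 1"
  defines "\<alpha> \<equiv> z + sqrt (z\<^sup>2 + K\<^sup>2) - sqrt (1 + K\<^sup>2)"
    and "\<beta> \<equiv> z - sqrt (z\<^sup>2 + K\<^sup>2) + sqrt (1 + K\<^sup>2)"
  shows "\<bar>\<alpha>\<bar> \<le> 1" "\<bar>\<beta>\<bar> \<le> 1" "\<alpha> \<le> \<beta>"
proof -
  let ?x = "sqrt (z\<^sup>2 + K\<^sup>2)" and ?y = "sqrt (1 + K\<^sup>2)"
  have z2: "z\<^sup>2 \<le> 1" using assms(1) by (simp add: abs_square_le_1)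
  have xy: "?x \<le> ?y" using z2 by simp
  have xz: "\<bar>z\<bar> \<le> ?x" by (rule real_le_rsqrt) simp
  have x2: "?x\<^sup>2 = z\<^sup>2 + K\<^sup>2" by simp
  have "?y \<le> ?x + (1 - \<bar>z\<bar>)"
  proof (rule real_le_lsqrt)
    have "0 \<le> 2 * ((1 - \<bar>z\<bar>) * (?x - \<bar>z\<bar>))" using xz assms(1) by simp
    also have "\<dots> = (?x + (1 - \<bar>z\<bar>))\<^sup>2 - ?x\<^sup>2 - (1 - \<bar>z\<bar>\<^sup>2)"
      by (simp only: power2_eq_square) (simp add: algebra_simps)
    finally show "1 + K\<^sup>2 \<le> (?x + (1 - \<bar>z\<bar>))\<^sup>2" unfolding x2 by simp
  qed (use xz assms(1) in linarith)
  thus "\<bar>\<alpha>\<bar> \<le> 1" "\<bar>\<beta>\<bar> \<le> 1" "\<alpha> \<le> \<beta>"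
    unfolding \<alpha>_def \<beta>_def using xy by linarith+
qed

text \<open>With x, y the two roots and d = y - x, the relation y^2 - x^2 = 1 - z^2 turns (1 -
  \<alpha>^2)(1 - \<beta>^2) into d^2 ((y + x)^2 + (y - x)^2 - 2(1 + z^2)) = 4 d^2 K^2, a perfect
  square. The sign of its root comes from \<alpha> \<le> \<beta> and K \<ge> 0.\<close>

lemma sin_product:
  fixes z K :: real
  assumes "\<bar>z\<bar> < 1" "K \<ge> 0"
  defines "\<alpha> \<equiv> z + sqrt (z\<^sup>2 + K\<^sup>2) - sqrt (1 + K\<^sup>2)"
    and "\<beta> \<equiv> z - sqrt (z\<^sup>2 + K\<^sup>2) + sqrt (1 + K\<^sup>2)"
  shows "sqrt (1 - \<alpha>\<^sup>2) * sqrt (1 - \<beta>\<^sup>2) = (\<beta> - \<alpha>) * K"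
proof -
  note bounds = half_gap_bounds[OF assms(1), of K, folded \<alpha>_def \<beta>_def]
  define x y where "x = sqrt (z\<^sup>2 + K\<^sup>2)" and "y = sqrt (1 + K\<^sup>2)"
  have x2: "x\<^sup>2 = z\<^sup>2 + K\<^sup>2" and y2: "y\<^sup>2 = 1 + K\<^sup>2" by (simp_all add: x_def y_def)
  define d where "d = y - x"
  have ab: "\<alpha> = z - d" "\<beta> = z + d" by (simp_all add: \<alpha>_def \<beta>_def d_def x_def y_def)
  have "(1 - \<alpha>\<^sup>2) * (1 - \<beta>\<^sup>2) = (1 - z\<^sup>2)\<^sup>2 + d\<^sup>2 * (d\<^sup>2 - 2 * (1 + z\<^sup>2))"
    unfolding ab by (simp add: power2_eq_square algebra_simps)
  also have "1 - z\<^sup>2 = d * (y + x)"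
    using x2 y2 by (simp add: d_def power2_eq_square algebra_simps)
  also have "(d * (y + x))\<^sup>2 + d\<^sup>2 * (d\<^sup>2 - 2 * (1 + z\<^sup>2)) = d\<^sup>2 * (2 * x\<^sup>2 + 2 * y\<^sup>2 - 2 * (1 + z\<^sup>2))"
    by (simp add: d_def power2_eq_square algebra_simps)
  also have "\<dots> = ((\<beta> - \<alpha>) * K)\<^sup>2"
    unfolding ab x2 y2 by (simp add: power2_eq_square algebra_simps)
  finally have "(1 - \<alpha>\<^sup>2) * (1 - \<beta>\<^sup>2) = ((\<beta> - \<alpha>) * K)\<^sup>2" .
  hence "sqrt ((1 - \<alpha>\<^sup>2) * (1 - \<beta>\<^sup>2)) = \<bar>(\<beta> - \<alpha>) * K\<bar>" by simp
  also have "\<dots> = (\<beta> - \<alpha>) * K" using bounds(3) assms(2) by simp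
  finally show ?thesis by (simp add: real_sqrt_mult)
qed

lemma radicands:
  fixes q S T :: real
  assumes qST: "q\<^sup>2 = S\<^sup>2 + T\<^sup>2" and T: "T \<noteq> 0" and q: "q \<noteq> 1" "q \<noteq> -1"
  shows "2 * q\<^sup>2 * (q\<^sup>2 - 2 * S + 1) / (T\<^sup>2 * (q\<^sup>2 - 1)\<^sup>2) + q * (2 * (q\<^sup>2 * (S - 2) + S)) / (T\<^sup>2 * (q\<^sup>2 - 1)\<^sup>2)
      = (1 / (q + 1))\<^sup>2 + ((q + S) / (T * (q + 1)))\<^sup>2"
    and "q\<^sup>2 * (q\<^sup>2 * (T\<^sup>2 + 2) - 4 * S - 3 * T\<^sup>2 + 2) / (T\<^sup>2 * (q\<^sup>2 - 1)\<^sup>2)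
      + q * (2 * (q\<^sup>2 * (S - 2) + S + T\<^sup>2)) / (T\<^sup>2 * (q\<^sup>2 - 1)\<^sup>2)
      = 1 + ((q + S) / (T * (q + 1)))\<^sup>2"
proof -
  have nz: "q + 1 \<noteq> 0" "q - 1 \<noteq> 0" "(q - 1)\<^sup>2 \<noteq> 0" using q by auto
  have T2: "T\<^sup>2 = q\<^sup>2 - S\<^sup>2" using qST by simp
  have den: "T\<^sup>2 * (q\<^sup>2 - 1)\<^sup>2 = (q - 1)\<^sup>2 * (T\<^sup>2 * (q + 1)\<^sup>2)"
    by (simp add: power2_eq_square algebra_simps)
  have "(1 / (q + 1))\<^sup>2 + ((q + S) / (T * (q + 1)))\<^sup>2 = (T\<^sup>2 + (q + S)\<^sup>2) / (T\<^sup>2 * (q + 1)\<^sup>2)"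
    unfolding power_divide power_mult_distrib using T nz
    by (simp add: add_divide_distrib[of "T\<^sup>2" "(q + S)\<^sup>2"]
        add_divide_distrib[of "T\<^sup>2 * (q + 1)\<^sup>2" "(q + S)\<^sup>2"])
  also have "\<dots> = ((q - 1)\<^sup>2 * (T\<^sup>2 + (q + S)\<^sup>2)) / (T\<^sup>2 * (q\<^sup>2 - 1)\<^sup>2)"
    unfolding den using nz(3) by (rule mult_divide_mult_cancel_left[symmetric])
  also have "(q - 1)\<^sup>2 * (T\<^sup>2 + (q + S)\<^sup>2) = 2 * q\<^sup>2 * (q\<^sup>2 - 2 * S + 1) + q * (2 * (q\<^sup>2 * (S - 2) + S))"
    unfolding T2 by (simp add: power2_eq_square algebra_simps)
  finally show "2 * q\<^sup>2 * (q\<^sup>2 - 2 * S + 1) / (T\<^sup>2 * (q\<^sup>2 - 1)\<^sup>2) + q * (2 * (q\<^sup>2 * (S - 2) + S)) / (T\<^sup>2 * (q\<^sup>2 - 1)\<^sup>2)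
      = (1 / (q + 1))\<^sup>2 + ((q + S) / (T * (q + 1)))\<^sup>2"
    by (simp only: add_divide_distrib)
  have "1 + ((q + S) / (T * (q + 1)))\<^sup>2 = (T\<^sup>2 * (q + 1)\<^sup>2 + (q + S)\<^sup>2) / (T\<^sup>2 * (q + 1)\<^sup>2)"
    unfolding power_divide power_mult_distrib using T nz
    by (simp add: add_divide_distrib[of "T\<^sup>2" "(q + S)\<^sup>2"]
        add_divide_distrib[of "T\<^sup>2 * (q + 1)\<^sup>2" "(q + S)\<^sup>2"])
  also have "\<dots> = ((q - 1)\<^sup>2 * (T\<^sup>2 * (q + 1)\<^sup>2 + (q + S)\<^sup>2)) / (T\<^sup>2 * (q\<^sup>2 - 1)\<^sup>2)"
    unfolding den using nz(3) by (rule mult_divide_mult_cancel_left[symmetric])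
  also have "(q - 1)\<^sup>2 * (T\<^sup>2 * (q + 1)\<^sup>2 + (q + S)\<^sup>2) =
      q\<^sup>2 * (q\<^sup>2 * (T\<^sup>2 + 2) - 4 * S - 3 * T\<^sup>2 + 2) + q * (2 * (q\<^sup>2 * (S - 2) + S + T\<^sup>2))"
    unfolding T2 by (simp add: power2_eq_square algebra_simps)
  finally show "q\<^sup>2 * (q\<^sup>2 * (T\<^sup>2 + 2) - 4 * S - 3 * T\<^sup>2 + 2) / (T\<^sup>2 * (q\<^sup>2 - 1)\<^sup>2)
      + q * (2 * (q\<^sup>2 * (S - 2) + S + T\<^sup>2)) / (T\<^sup>2 * (q\<^sup>2 - 1)\<^sup>2)
      = 1 + ((q + S) / (T * (q + 1)))\<^sup>2"
    by (simp only: add_divide_distrib)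
qed

text \<open>This is four times the autocorrelation of the sequence, with the cyclotomic numbers and
  the product of the sines already inserted. The terms in S cancel because \<alpha>^2 - \<beta>^2 =
  -2z(\<beta> - \<alpha>), the terms in q^2 collect to (q(\<alpha> + \<beta>))^2 = 4(qz)^2, and qz =
  1 - z removes q altogether.\<close>

lemma cosine_equation:
  fixes q S z \<alpha> \<beta> :: real
  assumes z: "z * (q + 1) = 1" and sum: "\<alpha> + \<beta> = 2 * z"
  shows "8 * \<alpha> - 4 + 2 * (q\<^sup>2 - 1) * (\<alpha> * \<beta>) + 4 * ((\<beta> - \<alpha>) * ((q + S) * z)) +
    (q\<^sup>2 - 3 + 2 * S) * \<alpha>\<^sup>2 + (q\<^sup>2 + 1 - 2 * S) * \<beta>\<^sup>2 = 0" (is "?E = 0")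
proof -
  have \<beta>: "\<beta> = 2 * z - \<alpha>" and qz: "q * z = 1 - z" using sum z by (simp_all add: algebra_simps)
  have "?E = 8 * \<alpha> - 4 + 4 * (q * z)\<^sup>2 - 2 * \<alpha> * \<beta> - 3 * \<alpha>\<^sup>2 + \<beta>\<^sup>2 + 4 * (\<beta> - \<alpha>) * (q * z)"
    unfolding \<beta> by (simp add: power2_eq_square algebra_simps)
  also have "\<dots> = 0"
    unfolding qz \<beta> by (simp add: power2_eq_square algebra_simps)
  finally show ?thesis .
qed

subsection \<open>Cyclotomic numbers of order four\<close>

text \<open>The product of the two representations writes p^2 as a sum of two squares in two ways.
  The prime p divides one of the cross terms s t' - s' t and s t' + s' t, which forces that term to
  vanish; their product is p(s^2 - s'^2).\<close>

lemma prime_sum_two_squares_unique: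
  fixes s t s' t' :: int
  assumes p: "prime p" and st: "p = s\<^sup>2 + t\<^sup>2" and st': "p = s'\<^sup>2 + t'\<^sup>2"
    and odd: "odd p" "odd s" "odd s'"
  shows "s\<^sup>2 = s'\<^sup>2 \<and> t\<^sup>2 = t'\<^sup>2"
proof -
  have p0: "p > 0" using p by (rule prime_gt_0_int)
  have "even t" using odd(1,2) st by simp
  have "even t'" using odd(1,3) st' by simp
  have pp: "p\<^sup>2 = (s\<^sup>2 + t\<^sup>2) * (s'\<^sup>2 + t'\<^sup>2)"
    unfolding st[symmetric] st'[symmetric] by (rule power2_eq_square)
  \<comment> \<open>The product s s' is odd and t t' is even.\<close>
  have cross: "s * s' + t * t' \<noteq> 0" "s * s' - t * t' \<noteq> 0"
  proof -
    have "odd (s * s' + t * t')" "odd (s * s' - t * t')" using odd \<open>even t\<close> \<open>even t'\<close> by auto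
    thus "s * s' + t * t' \<noteq> 0" "s * s' - t * t' \<noteq> 0" by (metis even_zero)+
  qed
  \<comment> \<open>A nonzero multiple of p already has a square of at least p^2, leaving no room
    for a nonzero v.\<close>
  have zero: "u = 0" if "p dvd u" "u\<^sup>2 + v\<^sup>2 = p\<^sup>2" "v \<noteq> 0" for u v :: int
  proof (rule ccontr)
    assume "u \<noteq> 0"
    with that(1) have "p \<le> \<bar>u\<bar>" using p0 dvd_imp_le_int[of u p] by simp
    hence "p\<^sup>2 \<le> u\<^sup>2" using p0 by (metis abs_le_square_iff abs_of_pos)
    moreover have "v\<^sup>2 > 0" using that(3) by simp
    ultimately show False using that(2) by linarith
  qed
  have prod: "(s * t' - s' * t) * (s * t' + s' * t) = p * (s\<^sup>2 - s'\<^sup>2)"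
  proof -
    have "(s * t' - s' * t) * (s * t' + s' * t) = s\<^sup>2 * t'\<^sup>2 - s'\<^sup>2 * t\<^sup>2"
      by (simp add: power2_eq_square algebra_simps)
    also have "t'\<^sup>2 = p - s'\<^sup>2" using st' by simp
    also have "t\<^sup>2 = p - s\<^sup>2" using st by simp
    finally show ?thesis by (simp add: algebra_simps)
  qed
  hence "p dvd (s * t' - s' * t) * (s * t' + s' * t)" by simp
  hence "p dvd s * t' - s' * t \<or> p dvd s * t' + s' * t" using p by (simp add: prime_dvd_mult_iff)
  moreover have "(s * t' - s' * t)\<^sup>2 + (s * s' + t * t')\<^sup>2 = p\<^sup>2"
    "(s * t' + s' * t)\<^sup>2 + (s * s' - t * t')\<^sup>2 = p\<^sup>2"
    unfolding pp by (simp_all add: power2_eq_square algebra_simps)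
  ultimately have "s * t' - s' * t = 0 \<or> s * t' + s' * t = 0" using zero cross by blast
  hence "(s * t' - s' * t) * (s * t' + s' * t) = 0" by simp
  hence "s\<^sup>2 = s'\<^sup>2" using prod p0 by simp
  thus ?thesis using st st' by simp
qed

section \<open>Indices modulo four and powers of the imaginary unit\<close>

lemma less_4_iff: "(n::nat) < 4 \<longleftrightarrow> n = 0 \<or> n = 1 \<or> n = 2 \<or> n = 3"
  by auto

lemma add_mod_4_eq_0:
  assumes "(i::nat) < 4" "c < 4" "(i + c) mod 4 = 0"
  shows "c = (4 - i) mod 4"
  using assms unfolding less_4_iff by (elim disjE) simp_all

text \<open>The index map (i, j) to (-i, j - i) modulo 4, induced on pairs of classes by inversion
  of residues, is an involution.\<close>

lemma diff_mod_4:
  assumes "(i::nat) < 4" "j < 4"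
  shows "(4 - (4 - i) mod 4) mod 4 = i" "(4 + (4 + j - i) mod 4 - (4 - i) mod 4) mod 4 = j"
    and "(j + (4 - i) mod 4) mod 4 = (4 + j - i) mod 4"
  using assms unfolding less_4_iff by (elim disjE; simp)+

lemma sum_lessThan_4: "(\<Sum>i<(4::nat). F i) = F 0 + F 1 + F 2 + F 3"
  by (simp add: eval_nat_numeral)

lemma i_power_mod_4: "\<i> ^ (n mod 4) = \<i> ^ n"
proof -
  have "\<i> ^ n = \<i> ^ (4 * (n div 4) + n mod 4)" by simp
  also have "\<dots> = \<i> ^ (n mod 4)" unfolding power_add power_mult by (simp add: power4_eq_xxxx)
  finally show ?thesis by simp
qed

lemma i_power_cnj: "\<i> ^ n * cnj (\<i> ^ n) = 1"
  by (simp flip: power_mult_distrib)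

lemma nat_mod_diff:
  assumes "i \<le> n"
  shows "nat ((int j - int i) mod int n) = (j + n - i) mod n"
proof -
  have "int (j + n - i) = int j - int i + int n" using assms by simp
  hence "int ((j + n - i) mod n) = (int j - int i) mod int n" by (simp add: zmod_int)
  thus ?thesis by (metis nat_int)
qed

section \<open>Quartic residue classes modulo p\<close>

locale quartic =
  fixes p g :: nat
  assumes prime: "prime p" and cong8: "[p = 1] (mod 8)" and root: "residue_primroot p g"
begin

text \<open>The quartic class of a residue; an unspecified value on multiples of \<open>p\<close>.\<close>

definition cls :: "int \<Rightarrow> nat" where
  "cls x = (SOME k. [int g ^ k = x] (mod int p)) mod 4"

lemma p_gt_1: "p > 1"
  using prime prime_gt_1_nat by blast

lemma eight_dvd: "8 dvd p - 1"
  using cong8 p_gt_1 by (simp add: cong_altdef_nat)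

lemma exists_power: 
  assumes "\<not> int p dvd x"
  shows "\<exists>k. [int g ^ k = x] (mod int p)"
proof -
  let ?y = "nat (x mod int p)"
  have "x mod int p \<noteq> 0" "x mod int p \<ge> 0" "x mod int p < int p"
    using assms p_gt_1 by (auto simp: dvd_eq_mod_eq_0)
  hence "?y \<in> totatives p" by (auto simp: totatives_prime[OF prime] nat_less_iff)
  then obtain k where "?y = g ^ k mod p"
    using residue_primroot_is_generator[OF p_gt_1 root] by (auto simp: bij_betw_def)
  hence "x mod int p = int (g ^ k mod p)" 
    using \<open>x mod int p \<ge> 0\<close> by simp
  thus ?thesis by (intro exI[of _ k]) (simp add: cong_def of_nat_mod)
qed

lemma power_cong_iff: "[int g ^ k = int g ^ l] (mod int p) \<longleftrightarrow> [k = l] (mod p - 1)"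
proof -
  have "[int g ^ k = int g ^ l] (mod int p) \<longleftrightarrow> [g ^ k = g ^ l] (mod p)"
    by (metis cong_int_iff of_nat_power)
  thus ?thesis using root prime
    by (simp add: order_divides_expdiff residue_primroot_def totient_prime)
qed

text \<open>Exponents of g are determined modulo p - 1, a multiple of 4, so the arbitrary choice
  made in \<open>cls\<close> disappears modulo 4.\<close>

lemma cls_eqI:
  assumes "[int g ^ k = x] (mod int p)"
  shows "cls x = k mod 4"
proof -
  let ?k = "SOME k. [int g ^ k = x] (mod int p)"
  have "[int g ^ ?k = x] (mod int p)" using assms by (rule someI)
  hence "[?k = k] (mod p - 1)" using assms power_cong_iff cong_sym cong_trans by blast
  moreover have "4 dvd p - 1" using eight_dvd by (rule dvd_trans[rotated]) simp
  ultimately have "[?k = k] (mod 4)" by (rule cong_dvd_modulus_nat)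
  thus ?thesis by (simp add: cls_def cong_def)
qed

lemma cls_mod [simp]: "cls (x mod int p) = cls x"
  by (simp add: cls_def cong_def)

lemma cls_cong: "[x = y] (mod int p) \<Longrightarrow> cls x = cls y"
  by (metis cls_mod cong_def)

lemma cls_less [simp]: "cls x < 4"
  by (simp add: cls_def)

lemma dvd_mult_iff: "int p dvd x * y \<longleftrightarrow> int p dvd x \<or> int p dvd y"
  using prime by (simp add: prime_dvd_mult_iff)

lemma cls_mult:
  assumes "\<not> int p dvd x" "\<not> int p dvd y"
  shows "cls (x * y) = (cls x + cls y) mod 4"
proof -
  obtain k l where kl: "[int g ^ k = x] (mod int p)" "[int g ^ l = y] (mod int p)"
    using assms exists_power by blast
  hence "[int g ^ (k + l) = x * y] (mod int p)" by (simp add: power_add cong_mult)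
  thus ?thesis using kl by (simp add: cls_eqI mod_add_eq)
qed

lemma cls_1 [simp]: "cls 1 = 0"
  using cls_eqI[of 0 1] by simp

lemma cls_g: "cls (int g) = 1"
  using cls_eqI[of 1 "int g"] by simp

lemma not_dvd_g: "\<not> int p dvd int g"
proof
  assume "int p dvd int g"
  moreover have "coprime p g" using root by (simp add: residue_primroot_def)
  ultimately show False using p_gt_1 by (simp add: coprime_absorb_left)
qed

text \<open>If -1 = g^k, then p - 1 divides 2k. As 8 divides p - 1, k is a multiple of 4, so -1 is a
  fourth power.\<close>

lemma cls_minus [simp]:
  assumes "\<not> int p dvd x"
  shows "cls (- x) = cls x"
proof -
  have n: "\<not> int p dvd -1" using p_gt_1 by simp
  then obtain k where k: "[int g ^ k = -1] (mod int p)" using exists_power by blast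
  have "[int g ^ (k + k) = (-1) * (-1)] (mod int p)" unfolding power_add by (intro cong_mult k)
  hence "[int g ^ (k + k) = int g ^ 0] (mod int p)" by simp
  hence "p - 1 dvd k + k" unfolding power_cong_iff by (simp add: cong_0_iff)
  hence "8 dvd 2 * k" using eight_dvd by (metis dvd_trans mult_2)
  hence "4 dvd k" by presburger
  hence "cls (-1) = 0" using cls_eqI[OF k] by simp
  thus ?thesis using cls_mult[OF n assms] by simp
qed

text \<open>An affine map with invertible slope permutes the residues. Periodicity of F allows its
  arguments to leave the range of summation.\<close>

lemma sum_affine:
  fixes F :: "int \<Rightarrow> 'a :: comm_monoid_add"
  assumes u: "\<not> int p dvd u" and F: "\<And>x. F (x mod int p) = F x"
  shows "(\<Sum>x\<in>{0..<int p}. F (u * x + c)) = sum F {0..<int p}"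
proof -
  let ?f = "\<lambda>x. (u * x + c) mod int p"
  have p0: "int p > 0" using p_gt_1 by simp
  have "inj_on ?f {0..<int p}"
  proof (rule inj_onI)
    fix x y assume xy: "x \<in> {0..<int p}" "y \<in> {0..<int p}" "?f x = ?f y"
    hence "int p dvd (u * x + c) - (u * y + c)" by (simp add: mod_eq_dvd_iff)
    hence "int p dvd u * (x - y)" by (simp add: algebra_simps)
    hence "int p dvd x - y" using u by (simp add: dvd_mult_iff)
    hence "x mod int p = y mod int p" by (simp add: mod_eq_dvd_iff)
    thus "x = y" using xy by simp
  qed
  moreover have "?f ` {0..<int p} \<subseteq> {0..<int p}" using p0 by auto
  ultimately have "bij_betw ?f {0..<int p} {0..<int p}"
    by (simp add: bij_betw_def endo_inj_surj)
  hence "(\<Sum>x\<in>{0..<int p}. F (?f x)) = sum F {0..<int p}"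
    by (rule sum.reindex_bij_betw)
  thus ?thesis by (simp add: F)
qed

lemma sum_shift:
  fixes F :: "int \<Rightarrow> 'a :: comm_monoid_add"
  assumes "\<And>x. F (x mod int p) = F x"
  shows "(\<Sum>x\<in>{0..<int p}. F (x + c)) = sum F {0..<int p}"
  using sum_affine[of 1 F c] assms p_gt_1 by simp

section \<open>Cyclotomic numbers and their symmetries\<close>

text \<open>The solutions counted by the classical cyclotomic number (i, j) of order four. The
  residues 0 and -1 are excluded explicitly because \<open>cls\<close> is unspecified on multiples
  of p.\<close>

definition cyc_set :: "nat \<Rightarrow> nat \<Rightarrow> int set" where
  "cyc_set i j = {x \<in> {0..<int p}. \<not> int p dvd x \<and> \<not> int p dvd x + 1 \<and> cls x = i \<and> cls (x + 1) = j}"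

definition cyc_num :: "nat \<Rightarrow> nat \<Rightarrow> nat" where
  "cyc_num i j = card (cyc_set i j)"

lemma finite_cyc_set [simp]: "finite (cyc_set i j)"
  by (rule finite_subset[of _ "{0..<int p}"]) (auto simp: cyc_set_def)

lemma dvd_mod_plus: "int p dvd x mod int p + c \<longleftrightarrow> int p dvd x + c"
  by (metis dvd_eq_mod_eq_0 mod_add_left_eq)

lemma cls_mod_plus: "cls (x mod int p + c) = cls (x + c)"
  by (rule cls_cong) (simp add: cong_def mod_add_left_eq)

text \<open>An injection modulo p is enough for what follows: each symmetry is an involution, so the
  reverse inequality is another instance.\<close>

lemma cyc_num_leI:
  assumes "\<And>x. x \<in> cyc_set i j \<Longrightarrow> \<not> int p dvd f x \<and> \<not> int p dvd f x + 1 \<and>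
      cls (f x) = k \<and> cls (f x + 1) = l"
    and "\<And>x y. \<lbrakk>x \<in> cyc_set i j; y \<in> cyc_set i j; [f x = f y] (mod int p)\<rbrakk> \<Longrightarrow> [x = y] (mod int p)"
  shows "cyc_num i j \<le> cyc_num k l"
  unfolding cyc_num_def
proof (rule card_inj_on_le[where f = "\<lambda>x. f x mod int p"])
  show "inj_on (\<lambda>x. f x mod int p) (cyc_set i j)"
  proof (rule inj_onI)
    fix x y assume xy: "x \<in> cyc_set i j" "y \<in> cyc_set i j" "f x mod int p = f y mod int p"
    hence "[x = y] (mod int p)" using assms(2)[of x y] by (simp add: cong_def)
    thus "x = y" using xy(1,2) by (simp add: cyc_set_def cong_def)
  qed
  show "(\<lambda>x. f x mod int p) ` cyc_set i j \<subseteq> cyc_set k l"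
  proof safe
    fix x assume "x \<in> cyc_set i j"
    from assms(1)[OF this] show "f x mod int p \<in> cyc_set k l"
      using p_gt_1 by (simp add: cyc_set_def dvd_mod_plus cls_mod_plus dvd_mod_iff)
  qed
qed simp

text \<open>The map x to -(x + 1) exchanges x and x + 1 up to sign, and signs do not change the
  class.\<close>

lemma cyc_num_swap: "cyc_num i j = cyc_num j i"
proof -
  have "cyc_num i j \<le> cyc_num j i" for i j
  proof (rule cyc_num_leI[where f = "\<lambda>x. - (x + 1)"])
    fix x assume x: "x \<in> cyc_set i j"
    hence x': "\<not> int p dvd x" "\<not> int p dvd x + 1" "cls x = i" "cls (x + 1) = j"
      by (auto simp: cyc_set_def)
    have e: "- (x + 1) + 1 = - x" by simp
    show "\<not> int p dvd - (x + 1) \<and> \<not> int p dvd - (x + 1) + 1 \<and>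
      cls (- (x + 1)) = j \<and> cls (- (x + 1) + 1) = i"
      unfolding e dvd_minus_iff using x' cls_minus[of "x + 1"] cls_minus[of x] by blast
  next
    fix x y assume "[- (x + 1) = - (y + 1)] (mod int p)"
    hence "[x + 1 = y + 1] (mod int p)" by (simp only: cong_minus_minus_iff)
    thus "[x = y] (mod int p)" by (simp only: cong_add_rcancel)
  qed
  thus ?thesis by (simp add: le_antisym)
qed

lemma cong_modular_inverse:
  assumes "\<not> int p dvd x"
  shows "[x * modular_inverse (int p) x = 1] (mod int p)"
  using assms prime prime_imp_coprime[of "int p" x]
  by (intro cong_modular_inverse1) (simp add: coprime_commute)

lemma not_dvd_modular_inverse:
  assumes "\<not> int p dvd x"
  shows "\<not> int p dvd modular_inverse (int p) x"
  using cong_dvd_iff[OF cong_modular_inverse[OF assms]] p_gt_1 by (auto simp: dvd_mult_iff)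

text \<open>Inversion sends x to y = 1/x, and (x + 1)y = y + 1, so the class of x is negated and
  then added to that of x + 1.\<close>

lemma cyc_num_inverse:
  assumes "i < 4" "j < 4"
  shows "cyc_num i j = cyc_num ((4 - i) mod 4) ((4 + j - i) mod 4)"
proof -
  let ?inv = "modular_inverse (int p)"
  have le: "cyc_num i j \<le> cyc_num ((4 - i) mod 4) ((4 + j - i) mod 4)" if ij: "i < 4" "j < 4" for i j
  proof (rule cyc_num_leI[where f = ?inv])
    fix x assume "x \<in> cyc_set i j"
    hence x: "\<not> int p dvd x" "\<not> int p dvd x + 1" "cls x = i" "cls (x + 1) = j"
      by (auto simp: cyc_set_def)
    let ?y = "?inv x"
    have y: "[x * ?y = 1] (mod int p)" "\<not> int p dvd ?y"
      using cong_modular_inverse[OF x(1)] not_dvd_modular_inverse[OF x(1)] by blast+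
    have "(i + cls ?y) mod 4 = 0"
      using cls_mult[of x ?y] x y cls_cong[OF y(1)] by simp
    hence cy: "cls ?y = (4 - i) mod 4" by (intro add_mod_4_eq_0 ij cls_less)
    have "[x * ?y + ?y = 1 + ?y] (mod int p)" using y(1) by (simp add: cong_add)
    hence *: "[(x + 1) * ?y = ?y + 1] (mod int p)" by (simp add: algebra_simps)
    have "\<not> int p dvd ?y + 1"
      using cong_dvd_iff[OF *] x y by (simp add: dvd_mult_iff)
    moreover have "cls (?y + 1) = (j + cls ?y) mod 4"
      using cls_mult[of "x + 1" ?y] x y cls_cong[OF *] by simp
    ultimately show "\<not> int p dvd ?y \<and> \<not> int p dvd ?y + 1 \<and> cls ?y = (4 - i) mod 4 \<and>
        cls (?y + 1) = (4 + j - i) mod 4"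
      using y(2) cy diff_mod_4(3)[OF ij] by simp
  next
    fix x y assume "x \<in> cyc_set i j" "y \<in> cyc_set i j" and *: "[?inv x = ?inv y] (mod int p)"
    hence "[x * ?inv x = 1] (mod int p)" "[y * ?inv y = 1] (mod int p)"
      by (auto simp: cyc_set_def intro: cong_modular_inverse)
    hence "[x * (y * ?inv y) = x * 1] (mod int p)" "[y * (x * ?inv x) = y * 1] (mod int p)"
      by (blast intro: cong_scalar_left)+
    moreover have "[x * (y * ?inv y) = y * (x * ?inv x)] (mod int p)"
      using cong_sym[OF cong_scalar_left[OF *, of "x * y"]] by (simp add: ac_simps)
    ultimately show "[x = y] (mod int p)" unfolding mult_1_right by (meson cong_sym cong_trans)
  qed
  \<comment> \<open>The inequality applied to the image indices leads back to (i, j).\<close>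
  have "cyc_num ((4 - i) mod 4) ((4 + j - i) mod 4) \<le> cyc_num i j"
  proof -
    have "(4 - i) mod 4 < 4" "(4 + j - i) mod 4 < 4" by simp_all
    from le[OF this] show ?thesis unfolding diff_mod_4[OF assms] .
  qed
  thus ?thesis using le[OF assms] by simp
qed

text \<open>The two symmetries split the sixteen index pairs into five orbits, of sizes 1, 3, 3, 3
  and 6, represented by 00, 01, 02, 03 and 12.\<close>

lemma cyc_num_sym:
  "cyc_num 1 0 = cyc_num 0 1" "cyc_num 3 3 = cyc_num 0 1" "cyc_num 3 0 = cyc_num 0 3"
  "cyc_num 1 1 = cyc_num 0 3" "cyc_num 2 0 = cyc_num 0 2" "cyc_num 2 2 = cyc_num 0 2"
  "cyc_num 1 3 = cyc_num 1 2" "cyc_num 3 1 = cyc_num 1 2" "cyc_num 2 1 = cyc_num 1 2" "cyc_num 2 3 = cyc_num 1 2" "cyc_num 3 2 = cyc_num 1 2"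
  using cyc_num_swap[of 0 1] cyc_num_inverse[of 1 0] cyc_num_swap[of 0 3] cyc_num_inverse[of 3 0]
    cyc_num_swap[of 0 2] cyc_num_inverse[of 2 0]
    cyc_num_inverse[of 1 2] cyc_num_swap[of 1 3] cyc_num_inverse[of 3 2]
    cyc_num_swap[of 2 3] cyc_num_swap[of 1 2] cyc_num_inverse[of 2 1]
  by simp_all

section \<open>Sums over residues of functions on the classes\<close>

text \<open>Extension by zero to the multiples of p; for \<open>u i = \<i> ^ i\<close> this is a
  quartic character.\<close>

definition ext :: "(nat \<Rightarrow> complex) \<Rightarrow> int \<Rightarrow> complex" where
  "ext u x = (if int p dvd x then 0 else u (cls x))"

lemma ext_mod [simp]:
  "ext u (x mod int p) = ext u x"
  "ext u (x mod int p + c) = ext u (x + c)"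
  by (simp_all add: ext_def dvd_mod_plus cls_mod_plus dvd_mod_iff)

lemma cnj_ext: "cnj (ext u x) = ext (\<lambda>i. cnj (u i)) x"
  by (simp add: ext_def)

lemma ext_mult: "ext u x * ext v x = ext (\<lambda>i. u i * v i) x"
  by (simp add: ext_def)

lemma ext_minus: "ext u (- x) = ext u x"
  by (simp add: ext_def)

lemma sum_delta:
  fixes F :: "int \<Rightarrow> complex"
  shows "(\<Sum>x\<in>{0..<int p}. if int p dvd x then F x else 0) = F 0"
proof -
  have "int p dvd x \<longleftrightarrow> x = 0" if "x \<in> {0..<int p}" for x
    using that zdvd_imp_le[of "int p" x] by (cases "0 < x") auto
  hence "(\<Sum>x\<in>{0..<int p}. if int p dvd x then F x else 0) = (\<Sum>x\<in>{0..<int p}. if x = 0 then F x else 0)"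
    by (intro sum.cong) simp_all
  thus ?thesis using p_gt_1 by simp
qed

lemma sum_ext_mult_g:
  "(\<Sum>x\<in>{0..<int p}. ext u x) = (\<Sum>x\<in>{0..<int p}. ext (\<lambda>i. u ((i + 1) mod 4)) x)"
proof -
  have "(\<Sum>x\<in>{0..<int p}. ext u x) = (\<Sum>x\<in>{0..<int p}. ext u (int g * x))"
    using sum_affine[of "int g" "ext u" 0] not_dvd_g by simp
  also have "\<dots> = (\<Sum>x\<in>{0..<int p}. ext (\<lambda>i. u ((i + 1) mod 4)) x)"
    using not_dvd_g by (intro sum.cong) (auto simp: ext_def dvd_mult_iff cls_mult cls_g)
  finally show ?thesis .
qed

text \<open>Multiplication by g rotates the classes without changing the sum. Adding the four
  rotations gives a function that is constant on the p - 1 nonzero residues.\<close>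

lemma sum_ext:
  "(\<Sum>x\<in>{0..<int p}. ext u x) = of_nat ((p - 1) div 4) * (\<Sum>i<4. u i)"
proof -
  define S where "S u = (\<Sum>x\<in>{0..<int p}. ext u x)" for u
  define v where "v i = u ((i + 1) mod 4)" for i
  define w where "w i = v ((i + 1) mod 4)" for i
  define y where "y i = w ((i + 1) mod 4)" for i
  have "S u = S v" "S v = S w" "S w = S y"
    unfolding S_def v_def w_def y_def by (rule sum_ext_mult_g)+
  hence "4 * S u = S u + S v + S w + S y" by simp
  also have "\<dots> = (\<Sum>x\<in>{0..<int p}. ext u x + ext v x + ext w x + ext y x)"
    by (simp add: S_def sum.distrib)
  also have "\<dots> = (\<Sum>x\<in>{0..<int p}. (\<Sum>i<4. u i) - (if int p dvd x then (\<Sum>i<4. u i) else 0))"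
  proof (rule sum.cong)
    fix x :: int
    have "cls x < 4" by simp
    hence "u (cls x) + v (cls x) + w (cls x) + y (cls x) = (\<Sum>i<4. u i)"
      unfolding less_4_iff by (elim disjE) (simp_all add: v_def w_def y_def sum_lessThan_4 numeral_2_eq_2[symmetric])
    thus "ext u x + ext v x + ext w x + ext y x = 
        (\<Sum>i<4. u i) - (if int p dvd x then (\<Sum>i<4. u i) else 0)" by (simp add: ext_def)
  qed simp
  also have "\<dots> = (of_nat p - 1) * (\<Sum>i<4. u i)"
    by (simp add: sum_subtractf sum_delta algebra_simps)
  also have "of_nat p - 1 = (of_nat (4 * ((p - 1) div 4)) :: complex)"
  proof -
    have "4 dvd p - 1" using eight_dvd by (rule dvd_trans[rotated]) simp
    hence "4 * ((p - 1) div 4) = p - 1" by simp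
    thus ?thesis using p_gt_1 by (simp add: of_nat_diff)
  qed
  finally show ?thesis by (simp add: S_def)
qed

text \<open>Replacing x by h x turns x + h into h(x + 1). Both classes are then shifted by the class
  of h, and grouping by the classes of x and x + 1 produces the cyclotomic numbers.\<close>

lemma sum_ext_ext:
  assumes "\<not> int p dvd h"
  shows "(\<Sum>x\<in>{0..<int p}. ext u x * ext v (x + h)) =
    (\<Sum>i<4. \<Sum>j<4. of_nat (cyc_num i j) * (u ((i + cls h) mod 4) * v ((j + cls h) mod 4)))"
proof -
  define U where "U = {x \<in> {0..<int p}. \<not> int p dvd x \<and> \<not> int p dvd x + 1}"
  define \<phi> where "\<phi> i j = u ((i + cls h) mod 4) * v ((j + cls h) mod 4)" for i j
  have fin: "finite U" unfolding U_def by (rule finite_subset[of _ "{0..<int p}"]) auto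
  have "(\<Sum>x\<in>{0..<int p}. ext u x * ext v (x + h)) =
      (\<Sum>x\<in>{0..<int p}. ext u (h * x + 0) * ext v ((h * x + 0) + h))"
    using assms by (intro sum_affine[symmetric]) simp_all
  also have "\<dots> = (\<Sum>x\<in>{0..<int p}. if x \<in> U then \<phi> (cls x) (cls (x + 1)) else 0)"
  proof (rule sum.cong)
    fix x assume x: "x \<in> {0..<int p}"
    have "h * x + 0 + h = h * (x + 1)" by (simp add: algebra_simps)
    thus "ext u (h * x + 0) * ext v (h * x + 0 + h) = (if x \<in> U then \<phi> (cls x) (cls (x + 1)) else 0)"
      using assms x by (simp add: ext_def dvd_mult_iff cls_mult U_def \<phi>_def add.commute)
  qed simp
  also have "\<dots> = (\<Sum>x\<in>U. \<phi> (cls x) (cls (x + 1)))"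
    by (intro sum.mono_neutral_cong_right) (auto simp: U_def)
  also have "\<dots> = (\<Sum>y\<in>{..<4}\<times>{..<4}. \<Sum>x\<in>{x \<in> U. (cls x, cls (x + 1)) = y}. \<phi> (cls x) (cls (x + 1)))"
    by (intro sum.group[symmetric] fin) auto
  also have "\<dots> = (\<Sum>(i,j)\<in>{..<4}\<times>{..<4}. of_nat (cyc_num i j) * \<phi> i j)"
  proof (rule sum.cong)
    fix y :: "nat \<times> nat"
    obtain i j where y: "y = (i, j)" by (cases y)
    have "{x \<in> U. (cls x, cls (x + 1)) = y} = cyc_set i j"
      by (auto simp: U_def cyc_set_def y)
    hence "(\<Sum>x\<in>{x \<in> U. (cls x, cls (x + 1)) = y}. \<phi> (cls x) (cls (x + 1))) = (\<Sum>x\<in>cyc_set i j. \<phi> i j)"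
      by (intro sum.cong) (auto simp: cyc_set_def)
    thus "(\<Sum>x\<in>{x \<in> U. (cls x, cls (x + 1)) = y}. \<phi> (cls x) (cls (x + 1))) =
        (case y of (i, j) \<Rightarrow> of_nat (cyc_num i j) * \<phi> i j)"
      by (simp add: y cyc_num_def)
  qed simp
  finally show ?thesis by (simp add: sum.cartesian_product \<phi>_def)
qed

text \<open>With the second function constantly 1, the correlation is the full sum of u without the
  term at x = -1, and -1 has class 0.\<close>

lemma row_sum:
  fixes u :: "nat \<Rightarrow> complex"
  shows "(\<Sum>i<4. u i * (\<Sum>j<4. of_nat (cyc_num i j))) = of_nat ((p - 1) div 4) * (\<Sum>i<4. u i) - u 0"
proof -
  have n: "\<not> int p dvd 1" using p_gt_1 by simp
  have "(\<Sum>i<4. u i * (\<Sum>j<4. of_nat (cyc_num i j))) = (\<Sum>x\<in>{0..<int p}. ext u x * ext (\<lambda>_. 1) (x + 1))"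
    by (subst sum_ext_ext[OF n]) (simp add: sum_distrib_left mult.commute)
  also have "\<dots> = (\<Sum>x\<in>{0..<int p}. ext u x - (if int p dvd x + 1 then ext u (x + 1 - 1) else 0))"
    by (intro sum.cong) (auto simp: ext_def)
  also have "\<dots> = (\<Sum>x\<in>{0..<int p}. ext u x) - 
      (\<Sum>x\<in>{0..<int p}. (if int p dvd x + 1 then ext u (x + 1 - 1) else 0))"
    by (rule sum_subtractf)
  also have "(\<Sum>x\<in>{0..<int p}. (if int p dvd x + 1 then ext u (x + 1 - 1) else 0)) =
      (\<Sum>x\<in>{0..<int p}. (if int p dvd x then ext u (x - 1) else 0))"
  proof (rule sum_shift)
    fix x
    have "ext u (x mod int p - 1) = ext u (x - 1)" using ext_mod(2)[of u x "-1"] by simp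
    thus "(if int p dvd x mod int p then ext u (x mod int p - 1) else 0) =
        (if int p dvd x then ext u (x - 1) else 0)" by (simp only: dvd_mod_iff dvd_refl)
  qed
  also have "\<dots> = ext u (- 1)" by (subst sum_delta) simp
  also have "\<dots> = u 0" using ext_minus[of u 1] n by (simp add: ext_def)
  finally show ?thesis by (simp add: sum_ext)
qed

lemma cyc_num_row:
  shows "cyc_num 0 0 + cyc_num 0 1 + cyc_num 0 2 + cyc_num 0 3 + 1 = (p - 1) div 4"
    and "cyc_num 0 1 + cyc_num 0 3 + 2 * cyc_num 1 2 = (p - 1) div 4"
    and "2 * cyc_num 0 2 + 2 * cyc_num 1 2 = (p - 1) div 4"
proof -
  \<comment> \<open>The indicator function of i isolates row i; the correction 1 in row 0 accounts
    for the missing residue -1.\<close>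
  have r: "(\<Sum>j<4. of_nat (cyc_num i j)) + (if i = 0 then 1 else 0) = (of_nat ((p - 1) div 4) :: complex)" 
    if "i < 4" for i
    using that row_sum[of "\<lambda>k. if k = i then 1 else 0"] unfolding less_4_iff
    by (elim disjE) (simp_all add: sum_lessThan_4)
  have r': "(\<Sum>j<4. cyc_num i j) + (if i = 0 then 1 else 0) = (p - 1) div 4" if "i < 4" for i
  proof -
    have "of_nat ((\<Sum>j<4. cyc_num i j) + (if i = 0 then 1 else 0)) = (of_nat ((p - 1) div 4) :: complex)"
      using r[OF that] by (cases "i = 0") (simp_all add: add.commute)
    thus ?thesis by (simp only: of_nat_eq_iff)
  qed
  show "cyc_num 0 0 + cyc_num 0 1 + cyc_num 0 2 + cyc_num 0 3 + 1 = (p - 1) div 4"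
       "cyc_num 0 1 + cyc_num 0 3 + 2 * cyc_num 1 2 = (p - 1) div 4"
       "2 * cyc_num 0 2 + 2 * cyc_num 1 2 = (p - 1) div 4"
    using r'[of 0] r'[of 1] r'[of 2] by (simp_all add: sum_lessThan_4 cyc_num_sym[unfolded One_nat_def])
qed

text \<open>Both sides sum \<open>a x * a y * cnj (a z * a w)\<close> over the solutions of \<open>x + y = z + w\<close>, that is \<open>x - z = w - y\<close>.\<close>

lemma convolution_energy:
  fixes a :: "int \<Rightarrow> complex"
  assumes per: "\<And>x. a (x mod int p) = a x"
  defines "conv \<equiv> \<lambda>h. \<Sum>x\<in>{0..<int p}. a x * a (h - x)"
    and "corr \<equiv> \<lambda>d. \<Sum>x\<in>{0..<int p}. a x * cnj (a (x + d))"
  shows "(\<Sum>h\<in>{0..<int p}. conv h * cnj (conv h)) = (\<Sum>d\<in>{0..<int p}. corr d * cnj (corr d))"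
proof -
  let ?Z = "{0..<int p}"
  have cong: "a x = a y" if "x mod int p = y mod int p" for x y
    by (metis per that)
  have per' [simp]: "a (x mod int p + c) = a (x + c)" "a (c + x mod int p) = a (c + x)"
    "a (x mod int p - c) = a (x - c)" "a (c - x mod int p) = a (c - x)" for x c
    by (rule cong, simp add: mod_simps)+
  have "(\<Sum>h\<in>?Z. conv h * cnj (conv h)) =
      (\<Sum>h\<in>?Z. \<Sum>x\<in>?Z. \<Sum>z\<in>?Z. a x * a (h - x) * (cnj (a z) * cnj (a (h - z))))"
    by (simp add: conv_def sum_product)
  also have "\<dots> = (\<Sum>x\<in>?Z. \<Sum>z\<in>?Z. \<Sum>h\<in>?Z. a x * a (h - x) * (cnj (a z) * cnj (a (h - z))))"
    by (subst sum.swap, rule sum.cong[OF refl], rule sum.swap)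
  also have "\<dots> = (\<Sum>x\<in>?Z. \<Sum>z\<in>?Z. \<Sum>y\<in>?Z. a x * a (y + x - x) * (cnj (a z) * cnj (a (y + x - z))))"
    by (intro sum.cong[OF refl] sum_shift[symmetric]) simp
  also have "\<dots> = (\<Sum>x\<in>?Z. \<Sum>y\<in>?Z. \<Sum>z\<in>?Z. a x * a y * (cnj (a z) * cnj (a (y + x - z))))"
    unfolding add_diff_cancel_right' by (intro sum.cong[OF refl] sum.swap)
  \<comment> \<open>After z = d + x the summand splits into a factor in x with shift d and a factor
    in y with shift -d.\<close>
  also have "\<dots> = (\<Sum>x\<in>?Z. \<Sum>y\<in>?Z. \<Sum>d\<in>?Z. a x * a y * (cnj (a (d + x)) * cnj (a (y + x - (d + x)))))"
    by (intro sum.cong[OF refl] sum_shift[symmetric]) (simp add: per)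
  also have "\<dots> = (\<Sum>x\<in>?Z. \<Sum>y\<in>?Z. \<Sum>d\<in>?Z. (a x * cnj (a (x + d))) * (a y * cnj (a (y - d))))"
    by (simp add: algebra_simps)
  also have "\<dots> = (\<Sum>x\<in>?Z. \<Sum>d\<in>?Z. \<Sum>y\<in>?Z. (a x * cnj (a (x + d))) * (a y * cnj (a (y - d))))"
    by (rule sum.cong[OF refl], rule sum.swap)
  also have "\<dots> = (\<Sum>d\<in>?Z. \<Sum>x\<in>?Z. \<Sum>y\<in>?Z. (a x * cnj (a (x + d))) * (a y * cnj (a (y - d))))"
    by (rule sum.swap)
  also have "\<dots> = (\<Sum>d\<in>?Z. corr d * (\<Sum>y\<in>?Z. a y * cnj (a (y - d))))"
    by (simp add: corr_def sum_product)
  also have "\<dots> = (\<Sum>d\<in>?Z. corr d * (\<Sum>y\<in>?Z. a (y + d) * cnj (a (y + d - d))))"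
  proof (rule sum.cong[OF refl])
    fix d
    have "(\<Sum>y\<in>?Z. a (y + d) * cnj (a (y + d - d))) = (\<Sum>y\<in>?Z. a y * cnj (a (y - d)))"
      by (rule sum_shift) (simp add: per)
    thus "corr d * (\<Sum>y\<in>?Z. a y * cnj (a (y - d))) =
        corr d * (\<Sum>y\<in>?Z. a (y + d) * cnj (a (y + d - d)))" by simp
  qed
  also have "\<dots> = (\<Sum>d\<in>?Z. corr d * cnj (corr d))"
    by (simp add: corr_def mult.commute)
  finally show ?thesis .
qed

section \<open>Evaluation of the cyclotomic numbers\<close>

text \<open>For the quartic character, the convolution vanishes at 0 and is a unit times the Jacobi
  sum J elsewhere, while the correlation is p - 1 at 0 and -1 elsewhere. Equality of energies reads
  (p - 1)|J|^2 = (p - 1)^2 + (p - 1), hence |J|^2 = p. The two squares are those of the real and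
  imaginary parts of J.\<close>

lemma jacobi_norm:
  "(8 * int (cyc_num 0 2) - 2 * int ((p - 1) div 4) + 1)\<^sup>2 + (2 * (int (cyc_num 0 1) - int (cyc_num 0 3)))\<^sup>2 = int p"
proof -
  define \<chi> where "\<chi> = ext (\<lambda>i. \<i> ^ i)"
  define conv where "conv h = (\<Sum>x\<in>{0..<int p}. \<chi> x * \<chi> (h - x))" for h
  define corr where "corr d = (\<Sum>x\<in>{0..<int p}. \<chi> x * cnj (\<chi> (x + d)))" for d
  define J where "J = (\<Sum>i<4. \<Sum>j<4. of_nat (cyc_num i j) * (\<i> ^ i * \<i> ^ j))"
  define f where "f = (p - 1) div 4"
  note row = cyc_num_row[folded f_def]
  have i3: "\<i> ^ 3 = - \<i>" by (simp add: power3_eq_cube)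
  have p: "of_nat p = (4 * of_nat f + 1 :: complex)"
  proof -
    have "4 dvd p - 1" using eight_dvd by (rule dvd_trans[rotated]) simp
    hence "p = 4 * f + 1" unfolding f_def using p_gt_1 by simp
    thus ?thesis by (metis of_nat_1 of_nat_add of_nat_mult of_nat_numeral)
  qed
  have conv0: "conv 0 = 0"
    unfolding conv_def \<chi>_def by (simp add: ext_minus ext_mult sum_ext sum_lessThan_4 i3)
  have corr0: "corr 0 = of_nat p - 1"
    unfolding corr_def \<chi>_def p
    by (simp only: cnj_ext add_0_right ext_mult i_power_cnj sum_ext) (simp add: sum_lessThan_4 f_def)
  have conv: "conv h * cnj (conv h) = J * cnj J" if h: "\<not> int p dvd h" for h
  proof -
    have h': "\<not> int p dvd - h" using h by simp
    \<comment> \<open>Evenness of the character makes the convolution a correlation with shift -h,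
      to which \<open>sum_ext_ext\<close> applies.\<close>
    have "\<chi> (h - x) = \<chi> (x + - h)" for x
      using ext_minus[of _ "x - h"] by (simp add: \<chi>_def)
    hence "conv h = (\<i> ^ cls h * \<i> ^ cls h) * J"
      unfolding conv_def \<chi>_def using h
      by (simp only: sum_ext_ext[OF h'] i_power_mod_4 J_def sum_distrib_left power_add cls_minus[OF h] mult_ac)
    hence "conv h * cnj (conv h) = (\<i> ^ cls h * cnj (\<i> ^ cls h)) * (\<i> ^ cls h * cnj (\<i> ^ cls h)) * (J * cnj J)"
      by (simp only: complex_cnj_mult mult_ac)
    thus ?thesis by (simp only: i_power_cnj mult_1_left)
  qed
  have rowc: "of_nat (cyc_num 0 0) = (of_nat f - 1 - 3 * of_nat (cyc_num 0 2) :: complex)"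
    "of_nat (cyc_num 0 1) + of_nat (cyc_num 0 3) = (2 * of_nat (cyc_num 0 2) :: complex)"
    "2 * of_nat (cyc_num 1 2) = (of_nat f - 2 * of_nat (cyc_num 0 2) :: complex)"
  proof -
    have "cyc_num 0 0 + 3 * cyc_num 0 2 + 1 = f" "cyc_num 0 1 + cyc_num 0 3 = 2 * cyc_num 0 2" "2 * cyc_num 1 2 + 2 * cyc_num 0 2 = f"
      using row by simp_all
    from this[THEN arg_cong[where f = "of_nat :: nat \<Rightarrow> complex"]]
    show "of_nat (cyc_num 0 0) = (of_nat f - 1 - 3 * of_nat (cyc_num 0 2) :: complex)"
      "of_nat (cyc_num 0 1) + of_nat (cyc_num 0 3) = (2 * of_nat (cyc_num 0 2) :: complex)"
      "2 * of_nat (cyc_num 1 2) = (of_nat f - 2 * of_nat (cyc_num 0 2) :: complex)"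
      by (simp_all add: algebra_simps)
  qed
  have corr: "corr h = - 1" if h: "\<not> int p dvd h" for h
  proof -
    have "corr h = (\<i> ^ cls h * cnj (\<i> ^ cls h)) * (\<Sum>i<4. \<Sum>j<4. of_nat (cyc_num i j) * (\<i> ^ i * cnj (\<i> ^ j)))"
      unfolding corr_def \<chi>_def cnj_ext
      by (simp only: sum_ext_ext[OF h] i_power_mod_4 sum_distrib_left power_add mult_ac complex_cnj_mult)
    also have "\<dots> = (\<Sum>i<4. \<Sum>j<4. of_nat (cyc_num i j) * (\<i> ^ i * cnj (\<i> ^ j)))"
      by (simp only: i_power_cnj mult_1_left)
    also have "\<dots> = of_nat (cyc_num 0 0) + (of_nat (cyc_num 0 1) + of_nat (cyc_num 0 3)) - of_nat (cyc_num 0 2) - 2 * of_nat (cyc_num 1 2)"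
      by (simp add: sum_lessThan_4 cyc_num_sym[unfolded One_nat_def] i3 algebra_simps)
    also have "\<dots> = - 1" unfolding rowc by simp
    finally show ?thesis .
  qed
  have split: "sum F {0..<int p} = F 0 + (\<Sum>h\<in>{1..<int p}. F h)" for F :: "int \<Rightarrow> complex"
  proof -
    have "{0..<int p} = insert 0 {1..<int p}" using p_gt_1 by auto
    thus ?thesis by simp
  qed
  have nd: "\<not> int p dvd h" if "h \<in> {1..<int p}" for h
    using that zdvd_imp_le[of "int p" h] by auto
  have "(\<Sum>h\<in>{0..<int p}. conv h * cnj (conv h)) = (\<Sum>d\<in>{0..<int p}. corr d * cnj (corr d))"
    unfolding conv_def corr_def by (rule convolution_energy) (simp add: \<chi>_def)
  moreover have "(\<Sum>h\<in>{0..<int p}. conv h * cnj (conv h)) = (of_nat p - 1) * (J * cnj J)"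
    unfolding split using p_gt_1 by (simp add: conv0 conv nd of_nat_diff)
  moreover have "(\<Sum>d\<in>{0..<int p}. corr d * cnj (corr d)) = (of_nat p - 1) * of_nat p"
    unfolding split using p_gt_1 by (simp add: corr0 corr nd of_nat_diff algebra_simps)
  moreover have "of_nat p - 1 \<noteq> (0 :: complex)" using p_gt_1 by simp
  ultimately have JJ: "J * cnj J = of_nat p" by simp
  define r where "r = 2 * int f - 1 - 8 * int (cyc_num 0 2)"
  define m where "m = 2 * (int (cyc_num 0 1) - int (cyc_num 0 3))"
  have "J = of_nat (cyc_num 0 0) + of_nat (cyc_num 0 2) - (of_nat (cyc_num 0 1) + of_nat (cyc_num 0 3)) - 2 * of_nat (cyc_num 0 2)
       + 2 * of_nat (cyc_num 1 2) + 2 * \<i> * (of_nat (cyc_num 0 1) - of_nat (cyc_num 0 3))"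
    unfolding J_def by (simp add: sum_lessThan_4 cyc_num_sym[unfolded One_nat_def] i3 algebra_simps)
  also have "\<dots> = of_int r + \<i> * of_int m"
    unfolding rowc r_def m_def by (simp add: algebra_simps)
  finally have "J * cnj J = of_int (r\<^sup>2 + m\<^sup>2)"
    by (simp add: algebra_simps power2_eq_square)
  hence "of_int (r\<^sup>2 + m\<^sup>2) = (of_int (int p) :: complex)" using JJ by simp
  hence "r\<^sup>2 + m\<^sup>2 = int p" by (simp only: of_int_eq_iff)
  moreover have "(8 * int (cyc_num 0 2) - 2 * int f + 1)\<^sup>2 = r\<^sup>2" 
    unfolding r_def by (simp add: power2_eq_square algebra_simps)
  ultimately show ?thesis unfolding f_def m_def by simp
qed

text \<open>The representation of p from the Jacobi sum agrees with s, t up to signs. Since (p -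
  1)/4 is even, its odd base is 1 modulo 4, as is s, which settles the first sign; the comparison of
  \<open>cyc_num 0 3\<close> with \<open>cyc_num 0 1\<close> settles the second. The third row
  relation then gives \<open>cyc_num 1 2\<close>.\<close>

lemma cyclotomic_values:
  fixes s t :: int
  assumes st: "int p = s\<^sup>2 + t\<^sup>2" and s: "[s = 1] (mod 4)" and t: "t > 0"
    and less: "cyc_num 0 3 < cyc_num 0 1"
  shows "16 * int (cyc_num 0 2) = int p - 3 + 2 * s" "16 * int (cyc_num 1 2) = int p + 1 - 2 * s"
    "2 * (int (cyc_num 0 1) - int (cyc_num 0 3)) = t"
proof -
  define f where "f = (p - 1) div 4"
  define s' where "s' = 8 * int (cyc_num 0 2) - 2 * int f + 1"
  define t' where "t' = 2 * (int (cyc_num 0 1) - int (cyc_num 0 3))"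
  have f: "even f" "4 * f = p - 1" using eight_dvd unfolding f_def by presburger+
  have p: "int p = 4 * int f + 1" using f(2) p_gt_1 by linarith
  have "odd p" using f(2) p_gt_1 by presburger
  have s4: "s mod 4 = 1" using s by (simp add: cong_def)
  have s'4: "s' mod 4 = 1" using f(1) unfolding s'_def by presburger
  have st': "int p = s'\<^sup>2 + t'\<^sup>2" using jacobi_norm by (simp add: s'_def t'_def f_def)
  have "odd s" "odd s'" using s4 s'4 by presburger+
  hence "s\<^sup>2 = s'\<^sup>2 \<and> t\<^sup>2 = t'\<^sup>2"
    using prime \<open>odd p\<close> by (intro prime_sum_two_squares_unique[OF _ st st']) simp_all
  hence sq: "s\<^sup>2 = s'\<^sup>2" "t\<^sup>2 = t'\<^sup>2" by simp_all
  have "s = s' \<or> s = - s'" using sq(1) by (simp add: power2_eq_iff)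
  hence ss: "s = s'" using s4 s'4 by presburger
  have "t' > 0" using less by (simp add: t'_def)
  thus "2 * (int (cyc_num 0 1) - int (cyc_num 0 3)) = t" using sq(2) t by (simp add: t'_def power2_eq_iff_nonneg)
  show "16 * int (cyc_num 0 2) = int p - 3 + 2 * s" unfolding ss s'_def p by simp
  moreover have "2 * int (cyc_num 0 2) + 2 * int (cyc_num 1 2) = int f" using cyc_num_row(3) unfolding f_def by linarith
  ultimately show "16 * int (cyc_num 1 2) = int p + 1 - 2 * s" using p by linarith
qed

subsection \<open>Autocorrelation and the Hadamard property\<close>

lemma cyc_class_iff:
  assumes "j < 4"
  shows "y \<in> cyc_class p g j \<longleftrightarrow> y < p \<and> \<not> int p dvd int y \<and> cls (int y) = j"
proof
  assume "y \<in> cyc_class p g j"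
  then obtain k where y: "y < p" and k: "[g ^ (4 * k + j) = y] (mod p)"
    by (auto simp: cyc_class_def)
  have k': "[int g ^ (4 * k + j) = int y] (mod int p)"
    using k by (metis cong_int_iff of_nat_power)
  have "\<not> int p dvd int g ^ (4 * k + j)"
    using not_dvd_g prime prime_dvd_power[of "int p" "int g" "4 * k + j"] by auto
  hence "\<not> int p dvd int y" using cong_dvd_iff[OF k'] by simp
  moreover have "cls (int y) = j" using cls_eqI[OF k'] assms by simp
  ultimately show "y < p \<and> \<not> int p dvd int y \<and> cls (int y) = j" using y by simp
next
  assume y: "y < p \<and> \<not> int p dvd int y \<and> cls (int y) = j"
  then obtain k where k: "[int g ^ k = int y] (mod int p)" using exists_power by blast
  hence j: "k mod 4 = j" using cls_eqI[OF k] y by simp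
  have "[g ^ k = y] (mod p)" using k by (metis cong_int_iff of_nat_power)
  hence "[g ^ (4 * (k div 4) + j) = y] (mod p)" unfolding j[symmetric] by simp
  thus "y \<in> cyc_class p g j" using y by (auto simp: cyc_class_def)
qed

text \<open>This translates the condition on the generator into cyclotomic numbers. For b = p - 1
  the successor wraps to 0, which lies in no class.\<close>

lemma card_cyc_class:
  assumes "l < 4"
  shows "card {b \<in> cyc_class p g 0. (b + 1) mod p \<in> cyc_class p g l} = cyc_num 0 l"
proof -
  let ?B = "{b \<in> cyc_class p g 0. (b + 1) mod p \<in> cyc_class p g l}"
  have suc: "int ((b + 1) mod p) = (int b + 1) mod int p" for b
    by (simp add: of_nat_mod add.commute)
  have mem: "b \<in> ?B \<longleftrightarrow> b < p \<and> int b \<in> cyc_set 0 l" for b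
    using p_gt_1 cyc_class_iff[of 0 b] cyc_class_iff[OF assms, of "(b + 1) mod p"]
    unfolding suc by (auto simp: cyc_set_def dvd_mod_iff)
  have "int ` ?B = cyc_set 0 l"
  proof (intro equalityI subsetI)
    fix x assume x: "x \<in> cyc_set 0 l"
    hence "x = int (nat x)" "nat x < p" by (auto simp: cyc_set_def nat_less_iff)
    thus "x \<in> int ` ?B" using mem[of "nat x"] x by (metis image_eqI)
  qed (use mem in auto)
  moreover have "card (int ` ?B) = card ?B" by (rule card_image) simp
  ultimately show ?thesis unfolding cyc_num_def by simp
qed

text \<open>X differs from \<open>ext u\<close> only by the value 1 at multiples of p. The terms at
  n = 0 and n = -d are distinct and contribute \<open>cnj (v 0)\<close> and \<open>v 0\<close>; the
  remaining terms form a class correlation.\<close>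

lemma autocorrelation:
  assumes d: "\<not> int p dvd d" and X: "\<And>n. X n = (if int p dvd n then 1 else u (cls n))"
  defines "v \<equiv> \<lambda>i. u ((i + cls d) mod 4)"
  shows "(\<Sum>n\<in>{0..<int p}. X n * cnj (X (n + d))) =
    v 0 + cnj (v 0) + (\<Sum>i<4. \<Sum>j<4. of_nat (cyc_num i j) * (v i * cnj (v j)))"
proof -
  let ?Z = "{0..<int p}"
  have pt: "X n * cnj (X (n + d)) = (if int p dvd n then cnj (ext u (n + d)) else 0) +
      ((if int p dvd n + d then ext u (n + d - d) else 0) + ext u n * ext (\<lambda>i. cnj (u i)) (n + d))" for n
  proof -
    have "\<not> (int p dvd n \<and> int p dvd n + d)" using d by (simp add: dvd_add_right_iff)
    thus ?thesis by (auto simp: X ext_def)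
  qed
  have "(\<Sum>n\<in>?Z. (if int p dvd n + d then ext u (n + d - d) else 0)) =
      (\<Sum>n\<in>?Z. (if int p dvd n then ext u (n - d) else 0))"
  proof (rule sum_shift)
    fix n
    have "ext u (n mod int p - d) = ext u (n - d)" using ext_mod(2)[of u n "-d"] by simp
    thus "(if int p dvd n mod int p then ext u (n mod int p - d) else 0) =
        (if int p dvd n then ext u (n - d) else 0)" by (simp only: dvd_mod_iff dvd_refl)
  qed
  also have "\<dots> = ext u (0 - d)" by (rule sum_delta)
  also have "\<dots> = v 0" using ext_minus[of u d] d by (simp add: ext_def v_def)
  finally have 1: "(\<Sum>n\<in>?Z. (if int p dvd n + d then ext u (n + d - d) else 0)) = v 0" .
  have 2: "(\<Sum>n\<in>?Z. (if int p dvd n then cnj (ext u (n + d)) else 0)) = cnj (v 0)"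
    using d by (subst sum_delta) (simp add: ext_def v_def)
  show ?thesis
    unfolding pt sum.distrib 1 2 sum_ext_ext[OF d] by (simp add: v_def)
qed

section \<open>From autocorrelations to the circulant matrix\<close>

text \<open>The inner product of rows i and j is, after translating the summation index by i, the
  autocorrelation at i - j.\<close>

lemma complex_hadamard_Circ:
  assumes X: "\<And>n. X n = x (nat (n mod int p))"
    and unit: "\<And>n. cmod (X n) = 1"
    and corr: "\<And>d. \<not> int p dvd d \<Longrightarrow> (\<Sum>n\<in>{0..<int p}. X n * cnj (X (n + d))) = 0"
  shows "complex_hadamard p (Circ p x)"
proof -
  have entry: "Circ p x $$ (i, j) = X (int j - int i)" if "i < p" "j < p" for i j
    using that nat_mod_diff[of i p j] by (simp add: Circ_def X)
  have per: "X (n mod int p + c) = X (n + c)" "X (n mod int p) = X n" for n c by (simp_all add: X mod_simps)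
  have "Circ p x * conj_transpose (Circ p x) = of_nat p \<cdot>\<^sub>m 1\<^sub>m p"
  proof (rule eq_matI)
    fix i j assume "i < dim_row (of_nat p \<cdot>\<^sub>m 1\<^sub>m p :: complex mat)" "j < dim_col (of_nat p \<cdot>\<^sub>m 1\<^sub>m p :: complex mat)"
    hence ij: "i < p" "j < p" by simp_all
    have "(Circ p x * conj_transpose (Circ p x)) $$ (i, j) =
        (\<Sum>k\<in>{0..<p}. Circ p x $$ (i, k) * cnj (Circ p x $$ (j, k)))"
      using ij by (simp add: conj_transpose_def scalar_prod_def Circ_def)
    also have "\<dots> = (\<Sum>k\<in>{0..<p}. X (int k - int i) * cnj (X (int k - int j)))"
      using ij by (intro sum.cong) (simp_all add: entry)
    also have "\<dots> = (\<Sum>n\<in>{0..<int p}. X (n - int i) * cnj (X (n - int j)))"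
      by (rule sum.reindex_bij_witness[of _ nat int]) auto
    also have "\<dots> = (\<Sum>n\<in>{0..<int p}. X (n + int i - int i) * cnj (X (n + int i - int j)))"
      using per(1)[of _ "- int i"] per(1)[of _ "- int j"] by (intro sum_shift[symmetric]) simp
    also have "\<dots> = (\<Sum>n\<in>{0..<int p}. X n * cnj (X (n + (int i - int j))))"
      by (simp add: algebra_simps)
    also have "\<dots> = (if i = j then of_nat p else 0)"
    proof (cases "i = j")
      case True
      have "X n * cnj (X n) = 1" for n
        using unit[of n] complex_norm_square[of "X n"] by simp
      thus ?thesis using True by simp
    next
      case False
      have "\<not> int p dvd int i - int j"
        using False ij dvd_imp_le_int[of "int i - int j" "int p"] by auto
      thus ?thesis using False corr by simp
    qed
    finally show "(Circ p x * conj_transpose (Circ p x)) $$ (i, j) = (of_nat p \<cdot>\<^sub>m 1\<^sub>m p) $$ (i, j)"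
      using ij by simp
  qed (simp_all add: conj_transpose_def Circ_def)
  thus ?thesis unfolding complex_hadamard_def
    using entry unit by (auto simp: Circ_def)
qed

lemma transpose_Circ:
  assumes X: "\<And>n. X n = x (nat (n mod int p))" and even: "\<And>n. X (- n) = X n"
  shows "transpose_mat (Circ p x) = Circ p x"
proof (rule eq_matI)
  fix i j assume "i < dim_row (Circ p x)" "j < dim_col (Circ p x)"
  hence ij: "i < p" "j < p" by (simp_all add: Circ_def)
  have e: "x ((j + p - i) mod p) = X (int j - int i)" if "i < p" "j < p" for i j
    using that nat_mod_diff[of i p j] by (simp add: X)
  show "transpose_mat (Circ p x) $$ (i, j) = Circ p x $$ (i, j)"
    using ij even[of "int j - int i"] by (simp add: Circ_def e)
qed (simp_all add: Circ_def)

text \<open>The values of v come in conjugate pairs, so by the symmetries of the cyclotomic numbers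
  the form is real. The sines \<open>\<alpha>'\<close> and \<open>\<beta>'\<close> may have either
  sign, which lets one statement serve all four rotations of the values.\<close>

lemma quadratic_form_zero:
  fixes \<alpha> \<beta> \<alpha>' \<beta>' :: real
  assumes circle: "\<alpha>\<^sup>2 + \<alpha>'\<^sup>2 = 1" "\<beta>\<^sup>2 + \<beta>'\<^sup>2 = 1"
    and eq: "8 * \<alpha> - 4 + 8 * real ((p - 1) div 4) * (\<alpha> * \<beta>)
      + 8 * (real (cyc_num 0 1) - real (cyc_num 0 3)) * (\<alpha>' * \<beta>')
      + 16 * real (cyc_num 0 2) * \<alpha>\<^sup>2 + 16 * real (cyc_num 1 2) * \<beta>\<^sup>2 = 0"
    and v: "v 0 = Complex \<alpha> \<alpha>'" "v 1 = Complex \<beta> \<beta>'" "v 2 = cnj (v 0)" "v 3 = cnj (v 1)"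
  shows "v 0 + cnj (v 0) + (\<Sum>i<4. \<Sum>j<4. of_nat (cyc_num i j) * (v i * cnj (v j))) = 0"
proof -
  define A B C D E f where "A = real (cyc_num 0 0)" "B = real (cyc_num 0 1)" "C = real (cyc_num 0 2)" "D = real (cyc_num 0 3)"
    "E = real (cyc_num 1 2)" "f = real ((p - 1) div 4)"
  note defs = this
  have row: "A + B + C + D + 1 = f" "B + D + 2 * E = f" "2 * C + 2 * E = f"
    using cyc_num_row[THEN arg_cong[where f = real]] by (simp_all add: defs)
  define R where "R = 2 * \<alpha> + (A + C) * (\<alpha>\<^sup>2 + \<alpha>'\<^sup>2) + (B + D) * (\<beta>\<^sup>2 + \<beta>'\<^sup>2) + 2 * (B + D + 2 * E) * (\<alpha> * \<beta>)
      + 2 * (B - D) * (\<alpha>' * \<beta>') + 2 * C * (\<alpha>\<^sup>2 - \<alpha>'\<^sup>2) + 2 * E * (\<beta>\<^sup>2 - \<beta>'\<^sup>2)"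
  have nat: "of_nat (cyc_num 0 0) = complex_of_real A" "of_nat (cyc_num 0 (Suc 0)) = complex_of_real B"
     "of_nat (cyc_num 0 2) = complex_of_real C" "of_nat (cyc_num 0 3) = complex_of_real D" "of_nat (cyc_num (Suc 0) 2) = complex_of_real E"
    by (simp_all add: defs)
  have "v 0 + cnj (v 0) + (\<Sum>i<4. \<Sum>j<4. of_nat (cyc_num i j) * (v i * cnj (v j))) = complex_of_real R"
    unfolding sum_lessThan_4 v(3,4) unfolding v(1,2) unfolding One_nat_def cyc_num_sym[unfolded One_nat_def] nat
    by (simp add: complex_eq_iff R_def power2_eq_square algebra_simps)
  also have "R = 0"
  proof -
    have \<alpha>': "\<alpha>'\<^sup>2 = 1 - \<alpha>\<^sup>2" and \<beta>': "\<beta>'\<^sup>2 = 1 - \<beta>\<^sup>2" using circle by simp_all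
    have "4 * R = 8 * \<alpha> + 4 * (A + B + C + D) - 8 * C - 8 * E + 8 * (B + D + 2 * E) * (\<alpha> * \<beta>)
        + 8 * (B - D) * (\<alpha>' * \<beta>') + 16 * C * \<alpha>\<^sup>2 + 16 * E * \<beta>\<^sup>2"
      unfolding R_def \<alpha>' \<beta>' by (simp add: algebra_simps)
    \<comment> \<open>By the row relations the constant is 4(f - 1) - 4f = -4, and the mixed
      coefficient B + D + 2E is f.\<close>
    also have "\<dots> = 8 * \<alpha> - 4 + 8 * f * (\<alpha> * \<beta>) + 8 * (B - D) * (\<alpha>' * \<beta>') + 16 * C * \<alpha>\<^sup>2 + 16 * E * \<beta>\<^sup>2"
      using row by simp
    also have "\<dots> = 0" using eq by (simp add: defs)
    finally show ?thesis by simp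
  qed
  finally show ?thesis by simp
qed

text \<open>Rotating (a, b, conj a, conj b) by an even amount preserves the product of the sines; an
  odd rotation exchanges \<alpha> with \<beta> and negates that product. Hence the shifts lead to
  only two equations.\<close>

lemma quartic_Circ_hadamard:
  fixes s t :: int and z K q \<alpha> \<beta> :: real and x :: "nat \<Rightarrow> complex"
  assumes st: "int p = s\<^sup>2 + t\<^sup>2" and s: "[s = 1] (mod 4)" and t: "t > 0"
    and less: "cyc_num 0 3 < cyc_num 0 1"
    and q: "q\<^sup>2 = real p" and z: "z * (q + 1) = 1" and K: "real_of_int t * K = (q + real_of_int s) * z"
    and le: "\<bar>\<alpha>\<bar> \<le> 1" "\<bar>\<beta>\<bar> \<le> 1"
    and sum: "\<alpha> + \<beta> = 2 * z" and prod: "sqrt (1 - \<alpha>\<^sup>2) * sqrt (1 - \<beta>\<^sup>2) = (\<beta> - \<alpha>) * K"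
    and a: "a = complex_of_real \<alpha> + \<i> * complex_of_real (sqrt (1 - \<alpha>\<^sup>2))"
    and b: "b = complex_of_real \<beta> + \<i> * complex_of_real (sqrt (1 - \<beta>\<^sup>2))"
    and x0: "x 0 = 1" and xk: "\<forall>j<4. \<forall>k\<in>cyc_class p g j. x k = [a, b, cnj a, cnj b] ! ((j + r) mod 4)"
  shows "complex_hadamard p (Circ p x) \<and> transpose_mat (Circ p x) = Circ p x"
proof -
  define cs where "cs = [a, b, cnj a, cnj b]"
  define u where "u j = cs ! ((j + r) mod 4)" for j
  define X where "X n = x (nat (n mod int p))" for n
  define \<alpha>' where "\<alpha>' = sqrt (1 - \<alpha>\<^sup>2)"
  define \<beta>' where "\<beta>' = sqrt (1 - \<beta>\<^sup>2)"
  have ab: "a = Complex \<alpha> \<alpha>'" "b = Complex \<beta> \<beta>'"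
    by (simp_all add: a b \<alpha>'_def \<beta>'_def complex_eq_iff)
  have "\<alpha>\<^sup>2 \<le> 1" "\<beta>\<^sup>2 \<le> 1" using le by (simp_all add: abs_square_le_1)
  hence circle: "\<alpha>\<^sup>2 + \<alpha>'\<^sup>2 = 1" "\<beta>\<^sup>2 + \<beta>'\<^sup>2 = 1" by (simp_all add: \<alpha>'_def \<beta>'_def)
  have Xu: "X n = (if int p dvd n then 1 else u (cls n))" for n
  proof (cases "int p dvd n")
    case True
    thus ?thesis by (simp add: X_def x0)
  next
    case False
    have "n mod int p \<ge> 0" "n mod int p < int p" using p_gt_1 by simp_all
    hence "nat (n mod int p) \<in> cyc_class p g (cls n)"
      using False cyc_class_iff[OF cls_less, of "nat (n mod int p)" n] by (simp add: nat_less_iff dvd_mod_iff)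
    thus ?thesis using False xk by (simp add: X_def u_def cs_def)
  qed
  have even: "X (- n) = X n" for n by (simp add: Xu)
  have unit: "cmod (X n) = 1" for n
  proof -
    have "cmod a = 1" "cmod b = 1" using circle by (simp_all add: ab cmod_def)
    moreover have "(cls n + r) mod 4 < 4" by simp
    ultimately have "cmod (u (cls n)) = 1"
      unfolding u_def cs_def less_4_iff by (elim disjE) simp_all
    thus ?thesis by (simp add: Xu)
  qed
  define T S where "T = real_of_int t" "S = real_of_int s"
  have N16: "16 * real (cyc_num 0 2) = q\<^sup>2 - 3 + 2 * S" "16 * real (cyc_num 1 2) = q\<^sup>2 + 1 - 2 * S"
    "2 * (real (cyc_num 0 1) - real (cyc_num 0 3)) = T"
    using cyclotomic_values[OF st s t less, THEN arg_cong[where f = real_of_int]]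
    unfolding q T_S_def by simp_all
  have f: "8 * real ((p - 1) div 4) = 2 * (q\<^sup>2 - 1)"
  proof -
    have "4 dvd p - 1" using eight_dvd by (rule dvd_trans[rotated]) simp
    hence "p = 4 * ((p - 1) div 4) + 1" using p_gt_1 by simp
    hence "real p = 4 * real ((p - 1) div 4) + 1" by (metis of_nat_1 of_nat_add of_nat_mult of_nat_numeral)
    thus ?thesis using q by simp
  qed
  \<comment> \<open>Both parities are instances: exchanging the cosines negates their difference, in
    step with the product of the sines.\<close>
  have ev: "8 * \<gamma> - 4 + 8 * real ((p - 1) div 4) * (\<gamma> * \<delta>) + 8 * (real (cyc_num 0 1) - real (cyc_num 0 3)) * y
      + 16 * real (cyc_num 0 2) * \<gamma>\<^sup>2 + 16 * real (cyc_num 1 2) * \<delta>\<^sup>2 = 0"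
    if "\<gamma> + \<delta> = 2 * z" "y = (\<delta> - \<gamma>) * K" for \<gamma> \<delta> y :: real
  proof -
    have "8 * (real (cyc_num 0 1) - real (cyc_num 0 3)) * y = 4 * (T * y)" using N16(3) by simp
    also have "T * y = (\<delta> - \<gamma>) * ((q + S) * z)" using K by (simp add: that T_S_def)
    finally show ?thesis unfolding N16 f
      using cosine_equation[OF z that(1), of S] by simp
  qed
  have e1: "8 * \<alpha> - 4 + 8 * real ((p - 1) div 4) * (\<alpha> * \<beta>)
      + 8 * (real (cyc_num 0 1) - real (cyc_num 0 3)) * (\<alpha>' * \<beta>')
      + 16 * real (cyc_num 0 2) * \<alpha>\<^sup>2 + 16 * real (cyc_num 1 2) * \<beta>\<^sup>2 = 0"
    using prod sum by (intro ev) (simp_all add: \<alpha>'_def \<beta>'_def)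
  have e2: "8 * \<beta> - 4 + 8 * real ((p - 1) div 4) * (\<beta> * \<alpha>)
      + 8 * (real (cyc_num 0 1) - real (cyc_num 0 3)) * (- (\<alpha>' * \<beta>'))
      + 16 * real (cyc_num 0 2) * \<beta>\<^sup>2 + 16 * real (cyc_num 1 2) * \<alpha>\<^sup>2 = 0"
    using prod sum by (intro ev) (simp_all add: \<alpha>'_def \<beta>'_def algebra_simps)
  have corr: "(\<Sum>n\<in>{0..<int p}. X n * cnj (X (n + d))) = 0" if d: "\<not> int p dvd d" for d
  proof -
    \<comment> \<open>The class of the shift and the cyclic permutation r of the values act together
      as a single rotation by m.\<close>
    define m where "m = (cls d + r) mod 4"
    define v where "v i = u ((i + cls d) mod 4)" for i
    have v: "v i = cs ! ((i + m) mod 4)" for i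
      unfolding v_def u_def m_def by (simp add: mod_simps add_ac)
    have "m < 4" by (simp add: m_def)
    hence "v 0 + cnj (v 0) + (\<Sum>i<4. \<Sum>j<4. of_nat (cyc_num i j) * (v i * cnj (v j))) = 0"
      unfolding less_4_iff
    proof (elim disjE)
      assume "m = 0"
      thus ?thesis by (intro quadratic_form_zero[OF circle e1]) (simp_all add: v cs_def ab)
    next
      assume "m = 1"
      thus ?thesis using e2 circle
        by (intro quadratic_form_zero[where \<alpha> = \<beta> and \<beta> = \<alpha> and \<alpha>' = \<beta>' and \<beta>' = "- \<alpha>'"])
          (simp_all add: v cs_def ab complex_cnj mult.commute)
    next
      assume "m = 2"
      thus ?thesis using e1 circle
        by (intro quadratic_form_zero[where \<alpha> = \<alpha> and \<beta> = \<beta> and \<alpha>' = "- \<alpha>'" and \<beta>' = "- \<beta>'"])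
          (simp_all add: v cs_def ab complex_cnj)
    next
      assume "m = 3"
      thus ?thesis using e2 circle
        by (intro quadratic_form_zero[where \<alpha> = \<beta> and \<beta> = \<alpha> and \<alpha>' = "- \<beta>'" and \<beta>' = \<alpha>'])
          (simp_all add: v cs_def ab complex_cnj mult.commute)
    qed
    thus ?thesis using autocorrelation[OF d, of X u] Xu unfolding v_def by simp
  qed
  have "complex_hadamard p (Circ p x)"
    using X_def unit corr by (rule complex_hadamard_Circ)
  moreover have "transpose_mat (Circ p x) = Circ p x"
    using X_def even by (rule transpose_Circ)
  ultimately show ?thesis ..
qed

end

section \<open>Specialization to the explicit radicals\<close>

text \<open>The abbreviations of the theorem enter as equations, so that each can be rewritten
  separately; reflexivity then discharges them.\<close>

lemma theorem3_unfolded: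
  fixes p g :: nat and s t :: int and \<sigma> P S T \<zeta> A B C D \<alpha> \<beta> :: real and a b :: complex
  assumes p: "prime p" "[p = 1] (mod 8)"
    and st: "int p = s\<^sup>2 + t\<^sup>2" and s: "[s = 1] (mod 4)" and t: "t > 0"
    and g: "residue_primroot p g"
    and card: "card {b \<in> cyc_class p g 0. (b + 1) mod p \<in> cyc_class p g 1}
           > card {b \<in> cyc_class p g 0. (b + 1) mod p \<in> cyc_class p g 3}"
    and \<sigma>: "\<sigma> = 1 \<or> \<sigma> = -1"
    and PST: "P = real p" "S = real_of_int s" "T = real_of_int t"
    and \<zeta>: "\<zeta> = 2 * (-1 + \<sigma> * sqrt P) / (P - 1)"
    and A: "A = 2 * P * (P - 2 * S + 1) / (T\<^sup>2 * (P - 1)\<^sup>2)"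
    and B: "B = \<sigma> * (2 * (P * (S - 2) + S)) / (T\<^sup>2 * (P - 1)\<^sup>2)"
    and C: "C = P * (P * (T\<^sup>2 + 2) - 4 * S - 3 * T\<^sup>2 + 2) / (T\<^sup>2 * (P - 1)\<^sup>2)"
    and D: "D = \<sigma> * (2 * (P * (S - 2) + S + T\<^sup>2)) / (T\<^sup>2 * (P - 1)\<^sup>2)"
    and \<alpha>: "\<alpha> = \<zeta> / 2 + sqrt (A + B * sqrt P) - sqrt (C + D * sqrt P)"
    and \<beta>: "\<beta> = \<zeta> / 2 - sqrt (A + B * sqrt P) + sqrt (C + D * sqrt P)"
    and a: "a = complex_of_real \<alpha> + \<i> * complex_of_real (sqrt (1 - \<alpha>\<^sup>2))"
    and b: "b = complex_of_real \<beta> + \<i> * complex_of_real (sqrt (1 - \<beta>\<^sup>2))"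
  shows "A + B * sqrt P > 0 \<and> C + D * sqrt P > 0 \<and> \<bar>\<alpha>\<bar> \<le> 1 \<and> \<bar>\<beta>\<bar> \<le> 1 \<and>
    (\<forall>r<4. \<forall>x :: nat \<Rightarrow> complex.
       (x 0 = 1 \<and> (\<forall>j<4. \<forall>k\<in>cyc_class p g j. x k = [a, b, cnj a, cnj b] ! ((j + r) mod 4)))
       \<longrightarrow> complex_hadamard p (Circ p x) \<and> transpose_mat (Circ p x) = Circ p x)"
proof -
  interpret quartic p g by unfold_locales (fact p g)+
  \<comment> \<open>The chosen sign is absorbed into q, and only q^2 = P is used to treat both signs
    uniformly.\<close>
  define q where "q = \<sigma> * sqrt P"
  define z where "z = 1 / (q + 1)"
  define K where "K = (q + S) / (T * (q + 1))"
  \<comment> \<open>This gives |q| \<ge> 3, so |q + 1| > 1 and |z| < 1 even for the negative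
    root.\<close>
  have "p \<ge> 9" using p_gt_1 eight_dvd by (auto dest!: dvd_imp_le)
  hence "P \<ge> 9" using PST by simp
  have qP: "q\<^sup>2 = P" using \<sigma> \<open>P \<ge> 9\<close> by (auto simp: q_def power_mult_distrib)
  have T: "T > 0" using t PST by simp
  have qST: "q\<^sup>2 = S\<^sup>2 + T\<^sup>2"
    using arg_cong[OF st, of real_of_int] by (simp add: qP PST)
  have "\<bar>3\<bar> \<le> \<bar>q\<bar>" using qP \<open>P \<ge> 9\<close> unfolding abs_le_square_iff by simp
  hence q3: "\<bar>q\<bar> \<ge> 3" by simp
  hence q1: "q \<noteq> 1" "q \<noteq> - 1" "\<bar>q + 1\<bar> > 1" by auto
  have "S\<^sup>2 < q\<^sup>2" using qST T by simp
  hence Sq: "\<bar>S\<bar> < \<bar>q\<bar>" by (metis abs_le_square_iff not_less)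
  have z1: "\<bar>z\<bar> < 1" using q1 by (simp add: z_def divide_less_eq_1)
  have zq: "z * (q + 1) = 1" using q1 by (simp add: z_def)
  \<comment> \<open>Since |S| < |q| and 1 < |q|, both q + S and q + 1 have the sign of q.\<close>
  have K0: "K > 0"
  proof (cases "q > 0")
    case True
    thus ?thesis using Sq T by (simp add: K_def)
  next
    case False
    hence "q + S < 0" "q + 1 < 0" using Sq q3 by linarith+
    thus ?thesis using T by (simp add: K_def divide_neg_neg mult_pos_neg)
  qed
  have TK: "T * K = (q + S) * z" using T by (simp add: K_def z_def)
  have \<zeta>z: "\<zeta> / 2 = z"
  proof -
    have den: "q\<^sup>2 - 1 = (q - 1) * (q + 1)" by (simp add: power2_eq_square algebra_simps)
    have num: "2 * (- 1 + q) = (q - 1) * 2" by simp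
    have "\<zeta> = (q - 1) * 2 / ((q - 1) * (q + 1))"
      unfolding \<zeta> q_def[symmetric] unfolding qP[symmetric] den num ..
    also have "\<dots> = 2 / (q + 1)"
      using q1 by (intro mult_divide_mult_cancel_left) simp
    also have "\<dots> = 2 * z" by (simp add: z_def)
    finally show ?thesis by simp
  qed
  have "B * sqrt P = q * (2 * (q\<^sup>2 * (S - 2) + S)) / (T\<^sup>2 * (q\<^sup>2 - 1)\<^sup>2)"
    unfolding B qP by (simp add: q_def)
  hence AB: "A + B * sqrt P = z\<^sup>2 + K\<^sup>2"
    using radicands(1)[OF qST _ q1(1,2)] T unfolding A z_def K_def qP by simp
  have "D * sqrt P = q * (2 * (q\<^sup>2 * (S - 2) + S + T\<^sup>2)) / (T\<^sup>2 * (q\<^sup>2 - 1)\<^sup>2)"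
    unfolding D qP by (simp add: q_def)
  hence CD: "C + D * sqrt P = 1 + K\<^sup>2"
    using radicands(2)[OF qST _ q1(1,2)] T unfolding C K_def qP by simp
  have \<alpha>z: "\<alpha> = z + sqrt (z\<^sup>2 + K\<^sup>2) - sqrt (1 + K\<^sup>2)" and \<beta>z: "\<beta> = z - sqrt (z\<^sup>2 + K\<^sup>2) + sqrt (1 + K\<^sup>2)"
    unfolding \<alpha> \<beta> AB CD \<zeta>z by simp_all
  have le: "\<bar>\<alpha>\<bar> \<le> 1" "\<bar>\<beta>\<bar> \<le> 1"
    unfolding \<alpha>z \<beta>z by (rule half_gap_bounds[OF z1])+
  have prod: "sqrt (1 - \<alpha>\<^sup>2) * sqrt (1 - \<beta>\<^sup>2) = (\<beta> - \<alpha>) * K"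
    unfolding \<alpha>z \<beta>z using K0 by (intro sin_product z1) simp
  have sum: "\<alpha> + \<beta> = 2 * z" by (simp add: \<alpha>z \<beta>z)
  have less: "cyc_num 0 3 < cyc_num 0 1" using card card_cyc_class[of 1] card_cyc_class[of 3] by simp
  have "complex_hadamard p (Circ p x) \<and> transpose_mat (Circ p x) = Circ p x"
    if "x 0 = 1" "\<forall>j<4. \<forall>k\<in>cyc_class p g j. x k = [a, b, cnj a, cnj b] ! ((j + r) mod 4)" for x r
    using st s t less _ zq _ le sum prod a b that
    by (rule quartic_Circ_hadamard) (use qP TK in \<open>simp_all add: PST\<close>)
  moreover have "z\<^sup>2 + K\<^sup>2 > 0" "1 + K\<^sup>2 > 0" using K0 by (simp_all add: add_nonneg_pos)
  ultimately show ?thesis using le unfolding AB CD by blast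
qed

theorem theorem3:
  fixes p g :: nat and s t :: int and \<sigma> :: real
  assumes "prime p" and "[p = 1] (mod 8)"
    and "int p = s\<^sup>2 + t\<^sup>2" and "[s = 1] (mod 4)" and "t > 0"
    and "residue_primroot p g"
    and "card {b \<in> cyc_class p g 0. (b + 1) mod p \<in> cyc_class p g 1}
           > card {b \<in> cyc_class p g 0. (b + 1) mod p \<in> cyc_class p g 3}"
    and "\<sigma> = 1 \<or> \<sigma> = -1"
  shows "let P = real p; S = real_of_int s; T = real_of_int t;
    \<zeta> = 2 * (-1 + \<sigma> * sqrt P) / (P - 1);
    A = 2 * P * (P - 2 * S + 1) / (T\<^sup>2 * (P - 1)\<^sup>2);
    B = \<sigma> * (2 * (P * (S - 2) + S)) / (T\<^sup>2 * (P - 1)\<^sup>2);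
    C = P * (P * (T\<^sup>2 + 2) - 4 * S - 3 * T\<^sup>2 + 2) / (T\<^sup>2 * (P - 1)\<^sup>2);
    D = \<sigma> * (2 * (P * (S - 2) + S + T\<^sup>2)) / (T\<^sup>2 * (P - 1)\<^sup>2);
    \<alpha> = \<zeta> / 2 + sqrt (A + B * sqrt P) - sqrt (C + D * sqrt P);
    \<beta> = \<zeta> / 2 - sqrt (A + B * sqrt P) + sqrt (C + D * sqrt P);
    a = complex_of_real \<alpha> + \<i> * complex_of_real (sqrt (1 - \<alpha>\<^sup>2));
    b = complex_of_real \<beta> + \<i> * complex_of_real (sqrt (1 - \<beta>\<^sup>2));
    cs = [a, b, cnj a, cnj b]
  in A + B * sqrt P > 0 \<and> C + D * sqrt P > 0 \<and> \<bar>\<alpha>\<bar> \<le> 1 \<and> \<bar>\<beta>\<bar> \<le> 1 \<and>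
    (\<forall>r<4. \<forall>x :: nat \<Rightarrow> complex.
       (x 0 = 1 \<and> (\<forall>j<4. \<forall>k\<in>cyc_class p g j. x k = cs ! ((j + r) mod 4)))
       \<longrightarrow> complex_hadamard p (Circ p x) \<and> transpose_mat (Circ p x) = Circ p x)"
  unfolding Let_def
  by (rule theorem3_unfolded[OF assms]) (rule refl)+

end
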